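(* Let $\mathcal{S}$ be a semiring such that, for all $m\in\mathbb{N}$, the Ehrenfeucht–Fraïssé game $G_m$ is both sound and complete for $\equiv_m$ on $\mathcal{S}$. Then $\mathcal{S}$ is isomorphic to the Boolean semiring $\mathbb{B}=(\{0,1\},\vee,\wedge,0,1)$.
   Context: A semiring is $\mathcal{S}=(S,+,\cdot,0,1)$ with $0\ne1$, commutative monoids $(S,+,0),(S,\cdot,1)$, distributivity, $0\cdot s=0$, naturally ordered ($s\le t:\Leftrightarrow\exists r\,(s+r=t)$ is a partial order). For a finite relational vocabulary $\tau$ and universe $A$, an $\mathcal{S}$-interpretation is a map $\pi$ from the literals $R\bar a,\neg R\bar a$ ($R\in\tau$, $\bar a$ from $A$) to $S$; model-defining if for each atom exactly one of $\pi(R\bar a),\pi(\neg R\bar a)$ is $0$. Formulae in negation normal form are evaluated with equalities by truth value, literals by $\pi$, $\vee,\exists$ as sums, $\wedge,\forall$ as products over the universe; $\pi_A\equiv_m\pi_B$ iff every sentence of quantifier rank $\le m$ gets the same value. In $G_m(\pi_A,\pi_B)$, for $m$ rounds Spoiler picks an element in one universe and Duplicator one in the other; Duplicator wins iff the resulting map $\bar a\mapsto\bar b$ is a local isomorphism (same equality pattern, $\pi_A(L(\bar a))=\pi_B(L(\bar b))$ for all $\tau$-literals $L$). $G_m$ is sound for $\equiv_m$ on $\mathcal{S}$ if for all model-defining $\mathcal{S}$-interpretations $\pi_A,\pi_B$, a Duplicator winning strategy in $G_m(\pi_A,\pi_B)$ implies $\pi_A\equiv_m\pi_B$; complete if $\pi_A\equiv_m\pi_B$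 implies that Duplicator has a winning strategy in $G_m(\pi_A,\pi_B)$. *)

theory Defs
  imports Main
begin

text \<open>
  A naturally ordered commutative semiring with \<open>0 \<noteq> 1\<close> is a type of sort
  \<open>{comm_semiring_1, canonically_ordered_monoid_add}\<close>: the second class says precisely that
  \<open>\<le>\<close> is a partial order satisfying \<open>s \<le> t \<longleftrightarrow> (\<exists>r. t = s + r)\<close>.
\<close>

section \<open>Vocabularies, literals and interpretations\<close>

text \<open>A vocabulary maps each of its relation symbols to its arity.\<close>

type_synonym 'r vocabulary = "'r \<rightharpoonup> nat"

text \<open>
  The argument type \<open>'e\<close> is instantiated with elements of a universe for the literals
  \<open>R a\<close>, \<open>\<not>R a\<close> on which an interpretation is defined, and with variables (or positions in a
  tuple) for the literals that occur in formulae.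
\<close>

datatype ('r, 'e) literal = Pos 'r "'e list" | Neg 'r "'e list"

fun literal_over :: "'r vocabulary \<Rightarrow> 'e set \<Rightarrow> ('r, 'e) literal \<Rightarrow> bool" where
  "literal_over \<tau> E (Pos R es) \<longleftrightarrow> \<tau> R = Some (length es) \<and> set es \<subseteq> E"
| "literal_over \<tau> E (Neg R es) \<longleftrightarrow> \<tau> R = Some (length es) \<and> set es \<subseteq> E"

text \<open>
  An interpretation is a total function on literals; only its values on literals over the given
  vocabulary and universe are ever relevant.
\<close>

type_synonym ('r, 'a, 's) interp = "('r, 'a) literal \<Rightarrow> 's"

definition model_defining ::
    "'r vocabulary \<Rightarrow> 'a set \<Rightarrow> ('r, 'a, 's::comm_semiring_1) interp \<Rightarrow> bool" where
  "model_defining \<tau> A \<pi> \<longleftrightarrow>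
     (\<forall>R as. \<tau> R = Some (length as) \<and> set as \<subseteq> A \<longrightarrow>
        (\<pi> (Pos R as) = 0) \<noteq> (\<pi> (Neg R as) = 0))"


section \<open>First-order formulae in negation normal form\<close>

datatype 'r fo =
    Eq nat nat
  | Neq nat nat
  | Lit "('r, nat) literal"
  | Or "'r fo" "'r fo"
  | And "'r fo" "'r fo"
  | Ex nat "'r fo"
  | All nat "'r fo"

fun formula_over :: "'r vocabulary \<Rightarrow> 'r fo \<Rightarrow> bool" where
  "formula_over \<tau> (Eq x y) \<longleftrightarrow> True"
| "formula_over \<tau> (Neq x y) \<longleftrightarrow> True"
| "formula_over \<tau> (Lit L) \<longleftrightarrow> literal_over \<tau> UNIV L"
| "formula_over \<tau> (Or \<phi> \<psi>) \<longleftrightarrow> formula_over \<tau> \<phi> \<and> formula_over \<tau> \<psi>"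
| "formula_over \<tau> (And \<phi> \<psi>) \<longleftrightarrow> formula_over \<tau> \<phi> \<and> formula_over \<tau> \<psi>"
| "formula_over \<tau> (Ex x \<phi>) \<longleftrightarrow> formula_over \<tau> \<phi>"
| "formula_over \<tau> (All x \<phi>) \<longleftrightarrow> formula_over \<tau> \<phi>"

fun free_vars :: "'r fo \<Rightarrow> nat set" where
  "free_vars (Eq x y) = {x, y}"
| "free_vars (Neq x y) = {x, y}"
| "free_vars (Lit L) = set2_literal L"
| "free_vars (Or \<phi> \<psi>) = free_vars \<phi> \<union> free_vars \<psi>"
| "free_vars (And \<phi> \<psi>) = free_vars \<phi> \<union> free_vars \<psi>"
| "free_vars (Ex x \<phi>) = free_vars \<phi> - {x}"
| "free_vars (All x \<phi>) = free_vars \<phi> - {x}"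

fun quantifier_rank :: "'r fo \<Rightarrow> nat" where
  "quantifier_rank (Eq x y) = 0"
| "quantifier_rank (Neq x y) = 0"
| "quantifier_rank (Lit L) = 0"
| "quantifier_rank (Or \<phi> \<psi>) = max (quantifier_rank \<phi>) (quantifier_rank \<psi>)"
| "quantifier_rank (And \<phi> \<psi>) = max (quantifier_rank \<phi>) (quantifier_rank \<psi>)"
| "quantifier_rank (Ex x \<phi>) = Suc (quantifier_rank \<phi>)"
| "quantifier_rank (All x \<phi>) = Suc (quantifier_rank \<phi>)"

definition sentence :: "'r vocabulary \<Rightarrow> 'r fo \<Rightarrow> bool" where
  "sentence \<tau> \<phi> \<longleftrightarrow> formula_over \<tau> \<phi> \<and> free_vars \<phi> = {}"

text \<open>Sums and products over \<open>A\<close> have their intended meaning only for finite \<open>A\<close>.\<close>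

fun eval :: "'a set \<Rightarrow> ('r, 'a, 's::comm_semiring_1) interp \<Rightarrow> (nat \<Rightarrow> 'a) \<Rightarrow> 'r fo \<Rightarrow> 's" where
  "eval A \<pi> v (Eq x y) = (if v x = v y then 1 else 0)"
| "eval A \<pi> v (Neq x y) = (if v x \<noteq> v y then 1 else 0)"
| "eval A \<pi> v (Lit L) = \<pi> (map_literal id v L)"
| "eval A \<pi> v (Or \<phi> \<psi>) = eval A \<pi> v \<phi> + eval A \<pi> v \<psi>"
| "eval A \<pi> v (And \<phi> \<psi>) = eval A \<pi> v \<phi> * eval A \<pi> v \<psi>"
| "eval A \<pi> v (Ex x \<phi>) = (\<Sum>a\<in>A. eval A \<pi> (v(x := a)) \<phi>)"
| "eval A \<pi> v (All x \<phi>) = (\<Prod>a\<in>A. eval A \<pi> (v(x := a)) \<phi>)"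

text \<open>The valuation chosen below is irrelevant, since only free variables are looked up.\<close>

lemma eval_cong_free_vars:
  assumes "\<And>x. x \<in> free_vars \<phi> \<Longrightarrow> v x = w x"
  shows "eval A \<pi> v \<phi> = eval A \<pi> w \<phi>"
  using assms
proof (induction \<phi> arbitrary: v w)
  case (Eq x y)
  have "v x = w x" "v y = w y" by (rule Eq, simp)+
  then show ?case by simp
next
  case (Neq x y)
  have "v x = w x" "v y = w y" by (rule Neq, simp)+
  then show ?case by simp
next
  case (Lit L)
  have "map_literal id v L = map_literal id w L"
    by (rule literal.map_cong[OF refl refl Lit]) simp
  then show ?case by simp
next
  case (Or \<phi> \<psi>)
  have "eval A \<pi> v \<phi> = eval A \<pi> w \<phi>" by (rule Or.IH(1), rule Or.prems, simp)
  moreover have "eval A \<pi> v \<psi> = eval A \<pi> w \<psi>" by (rule Or.IH(2), rule Or.prems, simp)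
  ultimately show ?case by simp
next
  case (And \<phi> \<psi>)
  have "eval A \<pi> v \<phi> = eval A \<pi> w \<phi>" by (rule And.IH(1), rule And.prems, simp)
  moreover have "eval A \<pi> v \<psi> = eval A \<pi> w \<psi>" by (rule And.IH(2), rule And.prems, simp)
  ultimately show ?case by simp
next
  case (Ex x \<phi>)
  have "eval A \<pi> (v(x := a)) \<phi> = eval A \<pi> (w(x := a)) \<phi>" for a
    by (rule Ex.IH) (metis DiffI Ex.prems fun_upd_apply free_vars.simps(6) singletonD)
  then show ?case by simp
next
  case (All x \<phi>)
  have "eval A \<pi> (v(x := a)) \<phi> = eval A \<pi> (w(x := a)) \<phi>" for a
    by (rule All.IH) (metis DiffI All.prems fun_upd_apply free_vars.simps(7) singletonD)
  then show ?case by simp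
qed

definition sentence_value :: "'a set \<Rightarrow> ('r, 'a, 's::comm_semiring_1) interp \<Rightarrow> 'r fo \<Rightarrow> 's" where
  "sentence_value A \<pi> \<phi> = eval A \<pi> (\<lambda>_. undefined) \<phi>"

definition equiv_upto ::
    "nat \<Rightarrow> 'r vocabulary \<Rightarrow> 'a set \<Rightarrow> ('r, 'a, 's::comm_semiring_1) interp \<Rightarrow>
      'b set \<Rightarrow> ('r, 'b, 's) interp \<Rightarrow> bool" where
  "equiv_upto m \<tau> A \<pi>A B \<pi>B \<longleftrightarrow>
     (\<forall>\<phi>. sentence \<tau> \<phi> \<and> quantifier_rank \<phi> \<le> m \<longrightarrow>
        sentence_value A \<pi>A \<phi> = sentence_value B \<pi>B \<phi>)"


section \<open>The Ehrenfeucht--Fraisse game\<close>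

text \<open>
  A position is the list of pairs of elements chosen so far. The tuples \<open>a\<close>, \<open>b\<close> are its
  projections, and a literal \<open>L\<close> whose arguments are indices is instantiated to
  \<open>L(a)\<close>, \<open>L(b)\<close>.
\<close>

definition local_isomorphism ::
    "'r vocabulary \<Rightarrow> ('r, 'a, 's) interp \<Rightarrow> ('r, 'b, 's) interp \<Rightarrow> ('a \<times> 'b) list \<Rightarrow> bool" where
  "local_isomorphism \<tau> \<pi>A \<pi>B p \<longleftrightarrow>
     (\<forall>i<length p. \<forall>j<length p. fst (p ! i) = fst (p ! j) \<longleftrightarrow> snd (p ! i) = snd (p ! j)) \<and>
     (\<forall>L. literal_over \<tau> {..<length p} L \<longrightarrow>
        \<pi>A (map_literal id (\<lambda>i. fst (p ! i)) L) = \<pi>B (map_literal id (\<lambda>i. snd (p ! i)) L))"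

text \<open>
  Spoiler's moves are \<open>Inl a\<close> (an element of the first universe) or \<open>Inr b\<close> (of the second).
  Duplicator's strategy consists of \<open>f\<close>, answering moves \<open>Inl a\<close>, and \<open>g\<close>, answering moves
  \<open>Inr b\<close>; both may depend on the current position. \<open>play f g p ms\<close> is the position reached
  from \<open>p\<close> when Spoiler plays \<open>ms\<close>.
\<close>

fun play ::
    "(('a \<times> 'b) list \<Rightarrow> 'a \<Rightarrow> 'b) \<Rightarrow> (('a \<times> 'b) list \<Rightarrow> 'b \<Rightarrow> 'a) \<Rightarrow>
      ('a \<times> 'b) list \<Rightarrow> ('a + 'b) list \<Rightarrow> ('a \<times> 'b) list" where
  "play f g p [] = p"
| "play f g p (Inl a # ms) = play f g (p @ [(a, f p a)]) ms"
| "play f g p (Inr b # ms) = play f g (p @ [(g p b, b)]) ms"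

text \<open>
  A strategy is winning if against all legal sequences of \<open>m\<close> Spoiler moves its answers are
  legal and the final position is a local isomorphism.
\<close>

definition duplicator_wins ::
    "nat \<Rightarrow> 'r vocabulary \<Rightarrow> 'a set \<Rightarrow> ('r, 'a, 's) interp \<Rightarrow> 'b set \<Rightarrow> ('r, 'b, 's) interp \<Rightarrow>
      bool" where
  "duplicator_wins m \<tau> A \<pi>A B \<pi>B \<longleftrightarrow>
     (\<exists>f g. \<forall>ms. length ms = m \<and> set ms \<subseteq> A <+> B \<longrightarrow>
        set (play f g [] ms) \<subseteq> A \<times> B \<and> local_isomorphism \<tau> \<pi>A \<pi>B (play f g [] ms))"


section \<open>Soundness and completeness of the game\<close>

text \<open>
  Universes are finite and nonempty, so up to isomorphism they are finite sets of natural numbers;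
  likewise for the symbols of a finite vocabulary. The vocabulary is not fixed in advance.
\<close>

definition admissible ::
    "nat vocabulary \<Rightarrow> nat set \<Rightarrow> (nat, nat, 's::comm_semiring_1) interp \<Rightarrow> bool" where
  "admissible \<tau> A \<pi> \<longleftrightarrow> finite (dom \<tau>) \<and> finite A \<and> A \<noteq> {} \<and> model_defining \<tau> A \<pi>"

definition game_sound :: "'s::comm_semiring_1 itself \<Rightarrow> nat \<Rightarrow> bool" where
  "game_sound _ m \<longleftrightarrow>
     (\<forall>\<tau> A B (\<pi>A :: (nat, nat, 's) interp) (\<pi>B :: (nat, nat, 's) interp).
        admissible \<tau> A \<pi>A \<and> admissible \<tau> B \<pi>B \<longrightarrow>
        duplicator_wins m \<tau> A \<pi>A B \<pi>B \<longrightarrow> equiv_upto m \<tau> A \<pi>A B \<pi>B)"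

definition game_complete :: "'s::comm_semiring_1 itself \<Rightarrow> nat \<Rightarrow> bool" where
  "game_complete _ m \<longleftrightarrow>
     (\<forall>\<tau> A B (\<pi>A :: (nat, nat, 's) interp) (\<pi>B :: (nat, nat, 's) interp).
        admissible \<tau> A \<pi>A \<and> admissible \<tau> B \<pi>B \<longrightarrow>
        equiv_upto m \<tau> A \<pi>A B \<pi>B \<longrightarrow> duplicator_wins m \<tau> A \<pi>A B \<pi>B)"

end

theory Submission
  imports Defs
begin

text \<open>
  With one unary relation, one round of the game only sees which values occur, not how often;
  soundness of \<open>G\<^sub>1\<close> thus makes addition and multiplication idempotent. If some element is
  neither 0 nor 1, there is such an \<open>x\<close> with \<open>1 + x \<in> {1, x}\<close>: either any such element is
  absorbed by 1, or some \<open>x = 1 + s\<close> with \<open>1 + s \<noteq> 1\<close> will do. Take four elements with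
  \<open>(R, \<not>R)\<close>-values \<open>(c, 0)\<close>, \<open>(0, 1)\<close>, \<open>(0, x)\<close>, \<open>(d, 0)\<close>, where \<open>{c, d} = {1, x}\<close> and
  \<open>c + d = c\<close>. Every quantifier-free formula in one variable denotes \<open>\<alpha> + \<beta> R + \<gamma> \<not>R\<close> with
  \<open>\<alpha>, \<beta>, \<gamma> \<in> {0, 1}\<close>, and dropping the last element changes neither the sum nor the product of
  the values of such an expression. So sentences of rank 1 do not see the missing element,
  whereas Spoiler wins by choosing it, contradicting completeness of \<open>G\<^sub>1\<close>.
\<close>

definition unary_vocabulary :: "nat vocabulary" where
  "unary_vocabulary = [0 \<mapsto> 1]"

lemma unary_vocabulary_eq_Some_iff [simp]:
  "unary_vocabulary R = Some n \<longleftrightarrow> R = 0 \<and> n = 1"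
  by (auto simp: unary_vocabulary_def)

lemma finite_dom_unary_vocabulary [simp]: "finite (dom unary_vocabulary)"
  by (simp add: unary_vocabulary_def)

fun unary_interp :: "(nat \<Rightarrow> 's) \<Rightarrow> (nat \<Rightarrow> 's) \<Rightarrow> (nat, nat, 's) interp" where
  "unary_interp P N (Pos _ as) = P (hd as)"
| "unary_interp P N (Neg _ as) = N (hd as)"

lemma literal_over_unary_cases:
  assumes "literal_over unary_vocabulary E L"
  obtains e where "e \<in> E" "L = Pos 0 [e]" | e where "e \<in> E" "L = Neg 0 [e]"
proof (cases L)
  case (Pos R es)
  with assms that(1) show ?thesis by (cases es) auto
next
  case (Neg R es)
  with assms that(2) show ?thesis by (cases es) auto
qed

lemma admissible_unary:
  assumes "finite A" "A \<noteq> {}" "\<And>a. a \<in> A \<Longrightarrow> (P a = 0) \<noteq> (N a = 0)"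
  shows "admissible unary_vocabulary A (unary_interp P N)"
proof -
  have "(P (hd as) = 0) \<noteq> (N (hd as) = 0)" if "length as = 1" "set as \<subseteq> A" for as
    using that assms(3) by (cases as) auto
  then show ?thesis
    using assms(1,2) by (auto simp: admissible_def model_defining_def)
qed

text \<open>A single pair has a trivial equality pattern, and each literal takes one value at all
  elements, so constant answers win whatever the sizes of \<open>A\<close> and
  \<open>B\<close>.\<close>

lemma duplicator_wins_constant:
  fixes P N :: "nat \<Rightarrow> 's"
  assumes P: "\<And>i. P i = s" and N: "\<And>i. N i = t" and "a \<in> A" "b \<in> B"
  shows "duplicator_wins 1 unary_vocabulary A (unary_interp P N) B (unary_interp P N)"
proof -
  have "set (play (\<lambda>_ _. b) (\<lambda>_ _. a) [] ms) \<subseteq> A \<times> B \<and>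
      local_isomorphism unary_vocabulary (unary_interp P N) (unary_interp P N)
        (play (\<lambda>_ _. b) (\<lambda>_ _. a) [] ms)"
    if "length ms = 1 \<and> set ms \<subseteq> A <+> B" for ms
  proof -
    from that obtain m where ms: "ms = [m]" by (cases ms) auto
    show ?thesis
      using that assms
      by (cases m) (auto simp: ms local_isomorphism_def elim!: literal_over_unary_cases)
  qed
  then show ?thesis unfolding duplicator_wins_def by blast
qed

lemma sound_imp_idempotent:
  fixes s :: "'s::comm_semiring_1"
  assumes "game_sound TYPE('s) 1"
  shows "s + s = s \<and> s * s = s"
proof (cases "s = 0")
  case False
  \<comment> \<open>For \<open>s = 0\<close> both literals would be 0 and this would not be
    model-defining, hence the case split.\<close>
  let ?\<pi> = "unary_interp (\<lambda>_. s) (\<lambda>_. 0)"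
  have "admissible unary_vocabulary {0} ?\<pi>" "admissible unary_vocabulary {0, 1} ?\<pi>"
    using False by (auto intro!: admissible_unary)
  moreover have "duplicator_wins 1 unary_vocabulary {0} ?\<pi> {0, 1} ?\<pi>"
    by (rule duplicator_wins_constant[where a = 0 and b = 0]) auto
  ultimately have "equiv_upto 1 unary_vocabulary {0} ?\<pi> {0, 1} ?\<pi>"
    using assms unfolding game_sound_def by blast
  then have "sentence_value {0} ?\<pi> \<phi> = sentence_value {0, 1} ?\<pi> \<phi>"
    if "sentence unary_vocabulary \<phi>" "quantifier_rank \<phi> \<le> 1" for \<phi>
    using that unfolding equiv_upto_def by blast
  \<comment> \<open>On one element both sentences have value \<open>s\<close>; on two they have
    values \<open>s + s\<close> and \<open>s * s\<close>.\<close>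
  from this[of "Ex 0 (Lit (Pos 0 [0]))"] this[of "All 0 (Lit (Pos 0 [0]))"]
  show ?thesis by (simp add: sentence_def sentence_value_def flip: mult_2)
qed simp

text \<open>
  A product of two such expressions is again linear, since \<open>P i * N i = 0\<close> and squares collapse;
  its coefficients stay in \<open>{0, 1}\<close> because \<open>1 + 1 = 1\<close>.
\<close>

lemma quantifier_free_linear:
  fixes P N :: "nat \<Rightarrow> 's::comm_semiring_1"
  assumes idem: "\<And>s::'s. s + s = s" "\<And>s::'s. s * s = s"
    and PN: "\<And>i. P i * N i = 0"
    and "formula_over unary_vocabulary \<phi>" "quantifier_rank \<phi> = 0"
  shows "\<exists>\<alpha>\<in>{0, 1}. \<exists>\<beta>\<in>{0, 1}. \<exists>\<gamma>\<in>{0, 1}.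
           \<forall>i. eval A (unary_interp P N) (\<lambda>_. i) \<phi> = \<alpha> + \<beta> * P i + \<gamma> * N i"
  using assms(4,5)
proof (induction \<phi>)
  case (Lit L)
  then have "literal_over unary_vocabulary UNIV L" by simp
  then show ?case by (cases rule: literal_over_unary_cases) auto
next
  case (Or \<phi> \<psi>)
  then have "formula_over unary_vocabulary \<phi>" "quantifier_rank \<phi> = 0"
    "formula_over unary_vocabulary \<psi>" "quantifier_rank \<psi> = 0"
    by auto
  with Or.IH obtain \<alpha> \<beta> \<gamma> \<alpha>' \<beta>' \<gamma>' where
    coeffs: "\<alpha> \<in> {0, 1}" "\<beta> \<in> {0, 1}" "\<gamma> \<in> {0, 1}" "\<alpha>' \<in> {0, 1}" "\<beta>' \<in> {0, 1}" "\<gamma>' \<in> {0, 1}" and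
    lin: "\<And>i. eval A (unary_interp P N) (\<lambda>_. i) \<phi> = \<alpha> + \<beta> * P i + \<gamma> * N i"
      "\<And>i. eval A (unary_interp P N) (\<lambda>_. i) \<psi> = \<alpha>' + \<beta>' * P i + \<gamma>' * N i"
    by meson
  have "eval A (unary_interp P N) (\<lambda>_. i) (Or \<phi> \<psi>) =
      (\<alpha> + \<alpha>') + (\<beta> + \<beta>') * P i + (\<gamma> + \<gamma>') * N i" for i
    by (simp add: lin algebra_simps)
  moreover have "\<alpha> + \<alpha>' \<in> {0, 1}" "\<beta> + \<beta>' \<in> {0, 1}" "\<gamma> + \<gamma>' \<in> {0, 1}"
    using coeffs idem(1)[of 1] by auto
  ultimately show ?case by blast
next
  case (And \<phi> \<psi>)
  then have "formula_over unary_vocabulary \<phi>" "quantifier_rank \<phi> = 0"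
    "formula_over unary_vocabulary \<psi>" "quantifier_rank \<psi> = 0"
    by auto
  with And.IH obtain \<alpha> \<beta> \<gamma> \<alpha>' \<beta>' \<gamma>' where
    coeffs: "\<alpha> \<in> {0, 1}" "\<beta> \<in> {0, 1}" "\<gamma> \<in> {0, 1}" "\<alpha>' \<in> {0, 1}" "\<beta>' \<in> {0, 1}" "\<gamma>' \<in> {0, 1}" and
    lin: "\<And>i. eval A (unary_interp P N) (\<lambda>_. i) \<phi> = \<alpha> + \<beta> * P i + \<gamma> * N i"
      "\<And>i. eval A (unary_interp P N) (\<lambda>_. i) \<psi> = \<alpha>' + \<beta>' * P i + \<gamma>' * N i"
    by meson
  have "eval A (unary_interp P N) (\<lambda>_. i) (And \<phi> \<psi>) =
      \<alpha> * \<alpha>' + (\<alpha> * \<beta>' + \<beta> * \<alpha>' + \<beta> * \<beta>') * P i + (\<alpha> * \<gamma>' + \<gamma> * \<alpha>' + \<gamma> * \<gamma>') * N i" for i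
  proof -
    have "eval A (unary_interp P N) (\<lambda>_. i) (And \<phi> \<psi>) =
      \<alpha> * \<alpha>' + (\<alpha> * \<beta>' + \<beta> * \<alpha>') * P i + \<beta> * \<beta>' * (P i * P i) +
      (\<alpha> * \<gamma>' + \<gamma> * \<alpha>') * N i + \<gamma> * \<gamma>' * (N i * N i) + (\<beta> * \<gamma>' + \<gamma> * \<beta>') * (P i * N i)"
      by (simp add: lin algebra_simps del: mult_zero_left mult_zero_right)
    then show ?thesis by (simp only: idem(2) PN) (simp add: algebra_simps)
  qed
  moreover have "\<alpha> * \<alpha>' \<in> {0, 1}" "\<alpha> * \<beta>' + \<beta> * \<alpha>' + \<beta> * \<beta>' \<in> {0, 1}"
    "\<alpha> * \<gamma>' + \<gamma> * \<alpha>' + \<gamma> * \<gamma>' \<in> {0, 1}"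
    using coeffs idem(1)[of 1] by auto
  ultimately show ?case by blast
qed auto

text \<open>Over this vocabulary every atom has a variable, so a sentence of rank at most 1 is built
  by \<open>Or\<close> and \<open>And\<close> from quantified formulae whose body is quantifier-free
  in one variable, hence linear.\<close>

lemma equiv_upto_1_unary:
  fixes P N :: "nat \<Rightarrow> 's::comm_semiring_1"
  assumes idem: "\<And>s::'s. s + s = s" "\<And>s::'s. s * s = s"
    and PN: "\<And>i. P i * N i = 0"
    and agree: "\<And>\<alpha> \<beta> \<gamma>. \<alpha> \<in> {0, 1} \<Longrightarrow> \<beta> \<in> {0, 1} \<Longrightarrow> \<gamma> \<in> {0, 1} \<Longrightarrow>
        (\<Sum>i\<in>A. \<alpha> + \<beta> * P i + \<gamma> * N i) = (\<Sum>i\<in>B. \<alpha> + \<beta> * P i + \<gamma> * N i) \<and>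
        (\<Prod>i\<in>A. \<alpha> + \<beta> * P i + \<gamma> * N i) = (\<Prod>i\<in>B. \<alpha> + \<beta> * P i + \<gamma> * N i)"
  shows "equiv_upto 1 unary_vocabulary A (unary_interp P N) B (unary_interp P N)"
proof -
  let ?\<pi> = "unary_interp P N"
  have quant: "eval A ?\<pi> v (Ex x \<phi>) = eval B ?\<pi> v (Ex x \<phi>) \<and>
      eval A ?\<pi> v (All x \<phi>) = eval B ?\<pi> v (All x \<phi>)"
    if over: "formula_over unary_vocabulary \<phi>" and rank: "quantifier_rank \<phi> = 0"
      and free: "free_vars \<phi> \<subseteq> {x}"
    for x \<phi> v
  proof -
    \<comment> \<open>Only quantifiers consult the universe, and only \<open>x\<close> is free, so
      \<open>quantifier_free_linear\<close> applies to both universes with the same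
      coefficients.\<close>
    have const: "eval C ?\<pi> (v(x := i)) \<phi> = eval A ?\<pi> (\<lambda>_. i) \<phi>" for C i
    proof -
      have "eval C ?\<pi> w \<phi> = eval A ?\<pi> w \<phi>" for w
        using rank by (induction \<phi>) auto
      moreover have "eval C ?\<pi> (v(x := i)) \<phi> = eval C ?\<pi> (\<lambda>_. i) \<phi>"
        using free by (intro eval_cong_free_vars) auto
      ultimately show ?thesis by simp
    qed
    obtain \<alpha> \<beta> \<gamma> where "\<alpha> \<in> {0, 1}" "\<beta> \<in> {0, 1}" "\<gamma> \<in> {0, 1}"
      "\<And>i. eval A ?\<pi> (\<lambda>_. i) \<phi> = \<alpha> + \<beta> * P i + \<gamma> * N i"
      using quantifier_free_linear[OF idem PN over rank, of A] by meson
    with agree[of \<alpha> \<beta> \<gamma>] show ?thesis by (simp add: const)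
  qed
  have "eval A ?\<pi> v \<phi> = eval B ?\<pi> v \<phi>"
    if "formula_over unary_vocabulary \<phi>" "quantifier_rank \<phi> \<le> 1" "free_vars \<phi> = {}" for v \<phi>
    using that
  proof (induction \<phi>)
    case (Ex x \<phi>)
    then show ?case by (intro quant[THEN conjunct1]) auto
  next
    case (All x \<phi>)
    then show ?case by (intro quant[THEN conjunct2]) auto
  qed auto
  then show ?thesis
    by (auto simp: equiv_upto_def sentence_def sentence_value_def)
qed

lemma complete_imp_no_third_value:
  fixes x :: "'s::comm_semiring_1"
  assumes complete: "game_complete TYPE('s) 1"
    and idem: "\<And>s::'s. s + s = s" "\<And>s::'s. s * s = s"
    and x: "1 + x \<in> {1, x}"
  shows "x \<in> {0, 1}"
proof (rule ccontr)
  assume "x \<notin> {0, 1}"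
  then have x01: "x \<noteq> 0" "x \<noteq> 1" by auto
  \<comment> \<open>\<open>c\<close> is the one of 1 and \<open>x\<close> that absorbs the other
    under addition; \<open>d\<close> is the absorbed one.\<close>
  define c d where "c = 1 + x" and "d = (if 1 + x = 1 then x else 1)"
  have cd: "c = 1 \<and> d = x \<and> 1 + x = 1 \<and> x + 1 = 1 \<or> c = x \<and> d = 1 \<and> 1 + x = x \<and> x + 1 = x"
    using x unfolding c_def d_def by (auto simp: add.commute)
  define P :: "nat \<Rightarrow> 's" where "P = (\<lambda>_. 0)(0 := c, 3 := d)"
  define N :: "nat \<Rightarrow> 's" where "N = (\<lambda>_. 0)(1 := 1, 2 := x)"
  let ?\<pi> = "unary_interp P N"
  let ?A = "{0, 1, 2, 3} :: nat set" and ?B = "{0, 1, 2} :: nat set"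
  have "equiv_upto 1 unary_vocabulary ?A ?\<pi> ?B ?\<pi>"
  proof (rule equiv_upto_1_unary[OF idem])
    show "P i * N i = 0" for i by (simp add: P_def N_def)
  next
    fix \<alpha> \<beta> \<gamma> :: 's
    assume coeffs: "\<alpha> \<in> {0, 1}" "\<beta> \<in> {0, 1}" "\<gamma> \<in> {0, 1}"
    let ?f = "\<lambda>i. \<alpha> + \<beta> * P i + \<gamma> * N i"
    have "?f 3 + ?f 0 = \<alpha> + \<alpha> + \<beta> * (c + d)"
      by (simp add: P_def N_def algebra_simps)
    also have "\<dots> = ?f 0"
      using cd by (auto simp: P_def N_def idem)
    finally have le: "?f 3 + ?f 0 = ?f 0" .
    have "sum ?f ?A = (?f 3 + ?f 0) + ?f 1 + ?f 2" by (simp add: ac_simps)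
    also have "\<dots> = sum ?f ?B" by (simp only: le) (simp add: ac_simps)
    finally have "sum ?f ?A = sum ?f ?B" .
    \<comment> \<open>If \<alpha> = 1, then \<open>?f 3 = 1\<close> because
      \<open>1 + d = 1\<close>. If \<alpha> = 0 and \<beta> or \<gamma> is 0, both products contain
      the factor 0, at element 0 or 1. If \<alpha> = 0 and \<beta> = \<gamma> = 1, both equal
      \<open>x\<close>: element 2 already supplies this factor, and
      \<open>x * x = x\<close>.\<close>
    moreover have "prod ?f ?A = prod ?f ?B"
      using coeffs cd idem(2)[of x] idem(1)[of 1]
      by (auto simp: P_def N_def add.assoc)
    ultimately show "sum ?f ?A = sum ?f ?B \<and> prod ?f ?A = prod ?f ?B" ..
  qed
  moreover have "admissible unary_vocabulary ?A ?\<pi>" "admissible unary_vocabulary ?B ?\<pi>"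
    using cd x01 by (auto intro!: admissible_unary simp: P_def N_def)
  ultimately have "duplicator_wins 1 unary_vocabulary ?A ?\<pi> ?B ?\<pi>"
    using complete unfolding game_complete_def by blast
  then obtain f g where win: "\<And>ms. length ms = 1 \<Longrightarrow> set ms \<subseteq> ?A <+> ?B \<Longrightarrow>
      set (play f g [] ms) \<subseteq> ?A \<times> ?B \<and> local_isomorphism unary_vocabulary ?\<pi> ?\<pi> (play f g [] ms)"
    unfolding duplicator_wins_def by blast
  define b where "b = f [] 3"
  have b: "b \<in> ?B" and iso: "local_isomorphism unary_vocabulary ?\<pi> ?\<pi> [(3, b)]"
    using win[of "[Inl 3]"] by (simp_all add: b_def InlI)
  \<comment> \<open>In \<open>Pos 0 [0]\<close> the first 0 is the relation symbol, the second the
    index of the only pair.\<close>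
  from iso have "?\<pi> (map_literal id (\<lambda>i. fst ([(3 :: nat, b)] ! i)) (Pos 0 [0])) =
      ?\<pi> (map_literal id (\<lambda>i. snd ([(3 :: nat, b)] ! i)) (Pos 0 [0]))"
    unfolding local_isomorphism_def by (elim conjE allE[of _ "Pos 0 [0]"]) simp
  then have "d = P b" by (simp add: P_def)
  moreover have "P b \<in> {c, 0}" using b by (auto simp: P_def)
  moreover have "d \<noteq> c" "d \<noteq> 0" using cd x01 by (metis zero_neq_one)+
  ultimately show False by simp
qed

theorem theorem3p7:
  assumes "\<forall>m. game_sound TYPE('s::{comm_semiring_1, canonically_ordered_monoid_add}) m \<and>
               game_complete TYPE('s) m"
  shows "\<exists>h :: 's \<Rightarrow> bool. bij h \<and> h 0 = False \<and> h 1 = True \<and>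
           (\<forall>x y. h (x + y) = (h x \<or> h y)) \<and> (\<forall>x y. h (x * y) = (h x \<and> h y))"
proof -
  have idem: "s + s = s" "s * s = s" for s :: 's
    using sound_imp_idempotent[of s] assms by blast+
  note no_third = complete_imp_no_third_value[OF _ idem]
  have absorb: "1 + s = 1" for s :: 's
  proof -
    \<comment> \<open>The element \<open>1 + s\<close> meets the alternative
      \<open>1 + x = x\<close> of \<open>no_third\<close>; the natural order then rules out the
      value 0.\<close>
    have "1 + (1 + s) = 1 + s" by (simp add: idem flip: add.assoc)
    then have "1 + s \<in> {0, 1}" using no_third[of "1 + s"] assms by simp
    then show ?thesis by (simp add: add_eq_0_iff_both_eq_0)
  qed
  \<comment> \<open>By \<open>absorb\<close>, every \<open>s\<close> now meets the other
    alternative, \<open>1 + x = 1\<close>.\<close>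
  have two: "s = 0 \<or> s = 1" for s :: 's
    using no_third[of s] assms absorb[of s] by simp
  have "bij (\<lambda>s::'s. s \<noteq> 0)"
  proof (rule bijI)
    show "inj (\<lambda>s::'s. s \<noteq> 0)" by (rule injI) (metis two)
    show "surj (\<lambda>s::'s. s \<noteq> 0)"
      by (rule surjI[where f = "\<lambda>b. if b then 1 else 0"]) simp
  qed
  moreover have "x * y \<noteq> 0 \<longleftrightarrow> x \<noteq> 0 \<and> y \<noteq> 0" for x y :: 's
    using two[of x] two[of y] by auto
  ultimately show ?thesis
    by (intro exI[of _ "\<lambda>s. s \<noteq> 0"]) (simp add: add_eq_0_iff_both_eq_0)
qed

end
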